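(* Let $X$ and $Y$ be non-empty sets. Suppose that there exists a lattice isomorphism $\Theta:\Sigma(X)\rightarrow\Sigma(Y)$. Then there exists a unique bijection $\theta:X\rightarrow Y$ such that (i) if $|X|$ is $1$, $2$ or infinite, then $\Theta=\theta_*$, and (ii) if $|X|$ is finite and more than $2$, then $\Theta=\theta_*$ or $\Theta=C\circ\theta_*$.
   Context: For a non-empty set $X$, $\Sigma(X)$ is the set of all topologies on $X$ (each topology viewed as its family of open sets), ordered by inclusion; it is a complete lattice. A lattice isomorphism is a bijection preserving joins and meets (equivalently, a bijection which, together with its inverse, preserves the order). For a bijection $\theta:X\to Y$, $\theta_*:\Sigma(X)\to\Sigma(Y)$ is defined by $\theta_*(T)=\{V\subset Y\mid\theta^{-1}(V)\in T\}$. For a finite set $Y$, the complement map $C:\Sigma(Y)\to\Sigma(Y)$ is $C(T)=\{Y\setminus U\mid U\in T\}$. *)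

theory Defs
  imports "HOL-Analysis.Abstract_Topology" "HOL-Algebra.Complete_Lattice"
begin

text \<open>
  A topology on \<open>X\<close> is its family of open sets.  The library predicate \<open>istopology\<close> asks for
  closure under binary intersections and arbitrary unions (hence the empty set is open); together
  with \<open>\<Union>T = X\<close> this says that \<open>X\<close> is the largest open set.
\<close>

definition topologies_on :: "'a set \<Rightarrow> 'a set set set" where
  "topologies_on X = {T. istopology (\<lambda>U. U \<in> T) \<and> \<Union>T = X}"

definition topology_lattice :: "'a set \<Rightarrow> 'a set set gorder" where
  "topology_lattice X = \<lparr>carrier = topologies_on X, eq = (=), le = (\<subseteq>)\<rparr>"

definition lattice_iso ::
    "('a, 'c) gorder_scheme \<Rightarrow> ('b, 'd) gorder_scheme \<Rightarrow> ('a \<Rightarrow> 'b) \<Rightarrow> bool" where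
  "lattice_iso L M f \<longleftrightarrow>
     bij_betw f (carrier L) (carrier M) \<and> join_pres L M f \<and> meet_pres L M f"

definition induced_map :: "'a set \<Rightarrow> 'b set \<Rightarrow> ('a \<Rightarrow> 'b) \<Rightarrow> 'a set set \<Rightarrow> 'b set set" where
  "induced_map X Y \<theta> T = {V. V \<subseteq> Y \<and> \<theta> -` V \<inter> X \<in> T}"

definition complement_map :: "'b set \<Rightarrow> 'b set set \<Rightarrow> 'b set set" where
  "complement_map Y T = {Y - U | U. U \<in> T}"

text \<open>
  The predicates \<open>join_pres\<close> and \<open>meet_pres\<close> include the requirement that both structures are
  lattices.  The next lemma shows that this is always met here.
\<close>

lemma complete_lattice_topology_lattice: "complete_lattice (topology_lattice X)"
proof -
  let ?L = "topology_lattice X"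
  have carr: "carrier ?L = topologies_on X" and le: "le ?L = (\<subseteq>)" and eq: "eq ?L = (=)"
    by (simp_all add: topology_lattice_def)
  interpret partial_order ?L
    by unfold_locales (auto simp: carr le eq)
  show ?thesis
  proof (rule complete_lattice_criterion1)
    have "Pow X \<in> topologies_on X"
      by (auto simp: topologies_on_def istopology_def)
    then have "greatest ?L (Pow X) (carrier ?L)"
      by (auto simp: greatest_def carr le topologies_on_def)
    then show "\<exists>g. greatest ?L g (carrier ?L)" ..
  next
    fix A assume A: "A \<subseteq> carrier ?L" "A \<noteq> {}"
    have top: "istopology (\<lambda>U. U \<in> T)" "\<Union>T = X" "X \<in> T" if "T \<in> A" for T
    proof -
      show *: "istopology (\<lambda>U. U \<in> T)" "\<Union>T = X"
        using that A by (auto simp: carr topologies_on_def)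
      then show "X \<in> T"
        unfolding istopology_def by blast
    qed
    have "istopology (\<lambda>U. U \<in> \<Inter>A)"
      using top(1) unfolding istopology_def by blast
    moreover have "\<Union>(\<Inter>A) = X"
      using top A(2) by blast
    ultimately have "\<Inter>A \<in> topologies_on X"
      by (simp add: topologies_on_def)
    then have "greatest ?L (\<Inter>A) (Lower ?L A)"
      using A by (auto simp: greatest_def Lower_def carr le)
    then show "\<exists>i. greatest ?L i (Lower ?L A)" ..
  qed
qed

end

theory Submission
  imports Defs
begin

text \<open>
  A topology \<open>T\<close> on \<open>X\<close> is determined by the atoms of \<open>\<Sigma>(X)\<close> below it: the atoms are the
  topologies \<open>{\<emptyset>, A, X}\<close> with \<open>A\<close> a nonempty proper subset, and \<open>{\<emptyset>, A, X} \<subseteq> T\<close> just means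
  \<open>A \<in> T\<close>.  A lattice isomorphism \<open>\<Theta>\<close> therefore amounts to a bijection \<open>\<phi>\<close> between the
  nonempty proper subsets of \<open>X\<close> and those of \<open>Y\<close> with \<open>\<phi> A \<in> \<Theta> T \<longleftrightarrow> A \<in> T\<close>
  (\<open>order_iso_generation_iso\<close>).  Since \<open>\<Theta>\<close> matches the topologies that contain two given sets,
  \<open>\<phi>\<close> carries the nontrivial members of the topology generated by \<open>A\<close> and \<open>B\<close>, that is
  \<open>{A, B, A \<inter> B, A \<union> B} - {\<emptyset>, X}\<close>, onto those generated by \<open>\<phi> A\<close> and \<open>\<phi> B\<close>.

  This alone nearly determines \<open>\<phi>\<close>.  Counting the generated sets shows that \<open>\<phi>\<close> preserves two
  notions.  First, \<open>A\<close> generates at most three nontrivial sets with every \<open>B\<close> exactly when \<open>A\<close> is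
  a singleton or the complement of one (\<open>extremal_subsets_iff\<close>).  Second, \<open>A\<close> and \<open>B\<close> generate
  no further set exactly when they are comparable or complementary
  (\<open>generated_pair_subset_pair_iff\<close>).  If \<open>X\<close> has at least three points, the second relation
  fails for two distinct singletons but holds between every singleton and every complement of a
  singleton, so \<open>\<phi>\<close> sends either all singletons to singletons or all of them to complements of
  singletons (\<open>singletons_or_cosingletons\<close>).  In the former case \<open>\<phi> {x} = {\<theta> x}\<close> defines a
  bijection \<open>\<theta>\<close>, and \<open>\<phi> A = \<theta> ` A\<close> because the membership of \<open>x\<close> in \<open>A\<close> is visible from the
  relation between \<open>{x}\<close> and \<open>A\<close> (\<open>point_map\<close>), whence \<open>\<Theta> = \<theta>\<^sub>*\<close>.  In the latter case the same
  argument applies to \<open>A \<mapsto> Y - \<phi> A\<close>, and \<open>\<Theta> = C \<circ> \<theta>\<^sub>*\<close>.  For infinite \<open>X\<close> that is impossible: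
  the complements of the sets of the cofinite topology are not closed under unions
  (\<open>complement_infinite_False\<close>).

  Uniqueness is read off the image of \<open>{\<emptyset>, {x}, X}\<close>, which contains \<open>{\<theta> x}\<close> or \<open>Y - {\<theta> x}\<close>; these
  cannot be confused when \<open>Y\<close> has more than two points.
\<close>

section \<open>Topologies generated by one or two sets\<close>

definition nontrivial_subsets :: "'a set \<Rightarrow> 'a set set" where
  "nontrivial_subsets X = {A. A \<subseteq> X \<and> A \<noteq> {} \<and> A \<noteq> X}"

definition generated_pair :: "'a set \<Rightarrow> 'a set \<Rightarrow> 'a set \<Rightarrow> 'a set set" where
  "generated_pair X A B = {A, B, A \<inter> B, A \<union> B} - {{}, X}"

text \<open>
  The empty set is a union over the empty family, and \<open>X\<close> the union of all open sets, so both
  may be listed among the axioms.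
\<close>

lemma topologies_on_iff:
  "T \<in> topologies_on X \<longleftrightarrow> T \<subseteq> Pow X \<and> {} \<in> T \<and> X \<in> T \<and>
     (\<forall>A\<in>T. \<forall>B\<in>T. A \<inter> B \<in> T) \<and> (\<forall>K. K \<subseteq> T \<longrightarrow> \<Union>K \<in> T)"
  (is "?l \<longleftrightarrow> ?r")
proof
  assume T: ?l
  then have union: "\<And>K. K \<subseteq> T \<Longrightarrow> \<Union>K \<in> T"
    unfolding topologies_on_def istopology_def by blast
  from union[of "{}"] union[of T] union T show ?r
    unfolding topologies_on_def istopology_def by auto
next
  assume T: ?r
  then have "\<Union>T = X" "\<forall>K. (\<forall>U\<in>K. U \<in> T) \<longrightarrow> \<Union>K \<in> T"
    by (blast, simp add: subset_iff)
  with T show ?l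
    unfolding topologies_on_def istopology_def by simp
qed

lemma topologies_onD:
  assumes "T \<in> topologies_on X"
  shows "T \<subseteq> Pow X" "{} \<in> T" "X \<in> T"
    "\<And>A B. A \<in> T \<Longrightarrow> B \<in> T \<Longrightarrow> A \<inter> B \<in> T" "\<And>A B. A \<in> T \<Longrightarrow> B \<in> T \<Longrightarrow> A \<union> B \<in> T"
    "\<And>K. K \<subseteq> T \<Longrightarrow> \<Union>K \<in> T"
proof -
  show "A \<union> B \<in> T" if "A \<in> T" "B \<in> T" for A B
  proof -
    have "\<Union>{A, B} \<in> T"
      using assms[unfolded topologies_on_iff] that by (metis empty_subsetI insert_subset)
    then show ?thesis by simp
  qed
qed (use assms[unfolded topologies_on_iff] in blast)+

lemma finite_topologyI:
  assumes "finite T" "T \<subseteq> Pow X" "{} \<in> T" "X \<in> T"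
    and "\<And>A B. A \<in> T \<Longrightarrow> B \<in> T \<Longrightarrow> A \<inter> B \<in> T"
    and union: "\<And>A B. A \<in> T \<Longrightarrow> B \<in> T \<Longrightarrow> A \<union> B \<in> T"
  shows "T \<in> topologies_on X"
proof -
  have "\<Union>K \<in> T" if "finite K" "K \<subseteq> T" for K
    using that by (induction K) (auto simp: assms(3) union)
  then show ?thesis
    using assms(2-5) finite_subset[OF _ assms(1)] unfolding topologies_on_iff by simp
qed

lemma generated_pair_topology:
  assumes "A \<subseteq> X" "B \<subseteq> X"
  shows "{{}, X, A, B, A \<inter> B, A \<union> B} \<in> topologies_on X"
proof (rule finite_topologyI)
  let ?T = "{{}, X, A, B, A \<inter> B, A \<union> B}"
  have X: "X \<inter> A = A" "A \<inter> X = A" "X \<inter> B = B" "B \<inter> X = B"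
    "X \<inter> (A \<inter> B) = A \<inter> B" "A \<inter> B \<inter> X = A \<inter> B"
    "X \<inter> (A \<union> B) = A \<union> B" "(A \<union> B) \<inter> X = A \<union> B"
    "X \<union> A = X" "A \<union> X = X" "X \<union> B = X" "B \<union> X = X"
    "X \<union> (A \<inter> B) = X" "A \<inter> B \<union> X = X" "X \<union> (A \<union> B) = X" "A \<union> B \<union> X = X"
    using assms by blast+
  have AB: "B \<inter> A = A \<inter> B" "A \<inter> (A \<inter> B) = A \<inter> B" "A \<inter> B \<inter> A = A \<inter> B"
    "B \<inter> (A \<inter> B) = A \<inter> B" "A \<inter> B \<inter> B = A \<inter> B" "A \<inter> (A \<union> B) = A" "(A \<union> B) \<inter> A = A"
    "B \<inter> (A \<union> B) = B" "(A \<union> B) \<inter> B = B" "A \<inter> B \<inter> (A \<union> B) = A \<inter> B"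
    "(A \<union> B) \<inter> (A \<inter> B) = A \<inter> B"
    "B \<union> A = A \<union> B" "A \<union> (A \<union> B) = A \<union> B" "A \<union> B \<union> A = A \<union> B"
    "B \<union> (A \<union> B) = A \<union> B" "A \<union> B \<union> B = A \<union> B" "A \<union> A \<inter> B = A" "A \<inter> B \<union> A = A"
    "B \<union> A \<inter> B = B" "A \<inter> B \<union> B = B" "A \<inter> B \<union> (A \<union> B) = A \<union> B"
    "A \<union> B \<union> A \<inter> B = A \<union> B"
    by blast+
  show "C \<inter> D \<in> ?T" if "C \<in> ?T" "D \<in> ?T" for C D
    using that by (elim insertE emptyE; simp only: X AB Int_absorb Int_empty_left Int_empty_right insert_iff simp_thms)
  show "C \<union> D \<in> ?T" if "C \<in> ?T" "D \<in> ?T" for C D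
    using that by (elim insertE emptyE; simp only: X AB Un_absorb Un_empty_left Un_empty_right insert_iff simp_thms)
qed (use assms in auto)

lemma single_topology:
  "A \<subseteq> X \<Longrightarrow> {{}, A, X} \<in> topologies_on X"
  using generated_pair_topology[of A X A] by (simp add: insert_commute)

lemma single_topology_inject:
  assumes "A \<in> nontrivial_subsets X" "{{}, A, X} = {{}, B, X}"
  shows "A = B"
proof -
  have "A \<in> {{}, B, X}"
    using assms(2) by (metis insertCI)
  then show ?thesis
    using assms(1) unfolding nontrivial_subsets_def by simp
qed

text \<open>
  This characterisation mentions only membership in topologies, so it passes through an order
  isomorphism, whereas intersections and unions of sets do not obviously do so.
\<close>

lemma generated_pair_iff:
  assumes "A \<in> nontrivial_subsets X" "B \<in> nontrivial_subsets X"
    and "C \<in> nontrivial_subsets X"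
  shows "C \<in> generated_pair X A B \<longleftrightarrow>
    (\<forall>T\<in>topologies_on X. A \<in> T \<longrightarrow> B \<in> T \<longrightarrow> C \<in> T)"
proof
  assume "C \<in> generated_pair X A B"
  then show "\<forall>T\<in>topologies_on X. A \<in> T \<longrightarrow> B \<in> T \<longrightarrow> C \<in> T"
    using topologies_onD(4,5) unfolding generated_pair_def by blast
next
  assume "\<forall>T\<in>topologies_on X. A \<in> T \<longrightarrow> B \<in> T \<longrightarrow> C \<in> T"
  moreover have "{{}, X, A, B, A \<inter> B, A \<union> B} \<in> topologies_on X"
    using assms(1,2) by (intro generated_pair_topology) (simp_all add: nontrivial_subsets_def)
  ultimately have "C \<in> {{}, X, A, B, A \<inter> B, A \<union> B}"
    by (metis insertCI)
  then show "C \<in> generated_pair X A B"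
    using assms(3) unfolding generated_pair_def nontrivial_subsets_def by blast
qed

lemma generated_pair_complement:
  assumes "A \<subseteq> X" "B \<subseteq> X"
  shows "generated_pair X (X - A) (X - B) = (\<lambda>C. X - C) ` generated_pair X A B"
proof -
  have inj: "inj_on (\<lambda>C. X - C) (Pow X)"
    by (rule inj_onI) blast
  have "(\<lambda>C. X - C) ` generated_pair X A B =
      (\<lambda>C. X - C) ` {A, B, A \<inter> B, A \<union> B} - (\<lambda>C. X - C) ` {{}, X}"
    unfolding generated_pair_def using assms by (intro inj_on_image_set_diff[OF inj]) auto
  also have "\<dots> = generated_pair X (X - A) (X - B)"
    unfolding generated_pair_def by (auto simp: Diff_Int Diff_Un)
  finally show ?thesis ..
qed

lemma generated_pair_subset:
  assumes "A \<in> nontrivial_subsets X" "B \<in> nontrivial_subsets X"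
  shows "generated_pair X A B \<subseteq> nontrivial_subsets X"
  using assms unfolding generated_pair_def nontrivial_subsets_def by auto

lemma generated_pair_subset_pair_iff:
  assumes "A \<in> nontrivial_subsets X" "B \<in> nontrivial_subsets X"
  shows "generated_pair X A B \<subseteq> {A, B} \<longleftrightarrow> A \<subseteq> B \<or> B \<subseteq> A \<or> B = X - A"
  using assms unfolding generated_pair_def nontrivial_subsets_def by auto

section \<open>Singletons and their complements\<close>

definition extremal_subsets :: "'a set \<Rightarrow> 'a set set" where
  "extremal_subsets X = {A \<in> nontrivial_subsets X. \<exists>x\<in>X. A = {x} \<or> A = X - {x}}"

text \<open>
  Intersecting with a singleton, or uniting with the complement of one, yields nothing new, which
  leaves room for at most one new set.  If \<open>A\<close> is of neither kind, a pair \<open>{a, b}\<close> with one point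
  inside and one point outside of \<open>A\<close> produces two new sets, \<open>{a}\<close> and \<open>A \<union> {b}\<close>.
\<close>

lemma extremal_subsets_iff:
  assumes A: "A \<in> nontrivial_subsets X"
  shows "A \<in> extremal_subsets X \<longleftrightarrow>
    (\<forall>B\<in>nontrivial_subsets X. card (generated_pair X A B) \<le> 3)"
proof
  assume "A \<in> extremal_subsets X"
  then obtain x where x: "x \<in> X" "A = {x} \<or> A = X - {x}"
    unfolding extremal_subsets_def by blast
  show "\<forall>B\<in>nontrivial_subsets X. card (generated_pair X A B) \<le> 3"
  proof
    fix B assume B: "B \<in> nontrivial_subsets X"
    have "\<exists>C. generated_pair X A B \<subseteq> {A, B, C}"
      using x(2)
    proof
      assume "A = {x}"
      then have "generated_pair X A B \<subseteq> {A, B, A \<union> B}"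
        unfolding generated_pair_def by auto
      then show ?thesis ..
    next
      assume "A = X - {x}"
      then have "generated_pair X A B \<subseteq> {A, B, A \<inter> B}"
        using B x(1) unfolding generated_pair_def nontrivial_subsets_def by auto
      then show ?thesis ..
    qed
    then obtain C where "generated_pair X A B \<subseteq> {A, B, C}" ..
    then have "card (generated_pair X A B) \<le> card {A, B, C}"
      by (intro card_mono) auto
    also have "\<dots> \<le> 3"
      by (simp add: card_insert_if)
    finally show "card (generated_pair X A B) \<le> 3" .
  qed
next
  assume small: "\<forall>B\<in>nontrivial_subsets X. card (generated_pair X A B) \<le> 3"
  show "A \<in> extremal_subsets X"
  proof (rule ccontr)
    assume neg: "A \<notin> extremal_subsets X"
    obtain a b where ab: "a \<in> A" "b \<in> X" "b \<notin> A"
      using A unfolding nontrivial_subsets_def by blast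
    have "A \<noteq> {a}" "A \<noteq> X - {b}"
      using neg A ab unfolding extremal_subsets_def nontrivial_subsets_def by auto
    then obtain a' b' where ab': "a' \<in> A" "a' \<noteq> a" "b' \<in> X" "b' \<notin> A" "b' \<noteq> b"
      using ab A unfolding nontrivial_subsets_def by blast
    have B: "{a, b} \<in> nontrivial_subsets X"
      using ab ab' A unfolding nontrivial_subsets_def by auto
    have "insert b A \<noteq> X" "A \<noteq> X" "{a, b} \<noteq> X" "{a} \<noteq> X" "A \<inter> {a, b} = {a}" "A \<union> {a, b} = insert b A"
      using ab ab' by auto
    then have "generated_pair X A {a, b} = {A, {a, b}, {a}, insert b A}"
      using ab unfolding generated_pair_def by auto
    moreover have "{a, b} \<noteq> {a}" "{a} \<noteq> insert b A" "A \<noteq> {a, b}" "A \<noteq> {a}" "A \<noteq> insert b A"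
      "{a, b} \<noteq> insert b A"
      using ab ab' by auto
    ultimately have "card (generated_pair X A {a, b}) = 4"
      by (simp add: card_insert_if)
    with small B show False by fastforce
  qed
qed

section \<open>Bijections of sets that respect generated topologies\<close>

text \<open>
  What an isomorphism of the lattices of topologies induces on nonempty proper subsets.  The
  condition on pairs suffices to recover the underlying point map, and it is invariant under
  complementation in \<open>Y\<close>, which the condition of mapping topologies to topologies is only for
  finite \<open>Y\<close>.
\<close>

locale generation_iso =
  fixes X :: "'a set" and Y :: "'b set" and \<phi> :: "'a set \<Rightarrow> 'b set"
  assumes bij: "bij_betw \<phi> (nontrivial_subsets X) (nontrivial_subsets Y)"
    and image_generated_pair:
      "\<And>A B. A \<in> nontrivial_subsets X \<Longrightarrow> B \<in> nontrivial_subsets X \<Longrightarrow>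
        \<phi> ` generated_pair X A B = generated_pair Y (\<phi> A) (\<phi> B)"
begin

lemma nontrivial: "A \<in> nontrivial_subsets X \<Longrightarrow> \<phi> A \<in> nontrivial_subsets Y"
  using bij by (rule bij_betwE[rule_format])

lemma eq_iff:
  "A \<in> nontrivial_subsets X \<Longrightarrow> B \<in> nontrivial_subsets X \<Longrightarrow> \<phi> A = \<phi> B \<longleftrightarrow> A = B"
  using bij by (meson bij_betw_imp_inj_on inj_on_eq_iff)

lemma surj:
  assumes "B \<in> nontrivial_subsets Y"
  obtains A where "A \<in> nontrivial_subsets X" "\<phi> A = B"
  using assms bij_betw_imp_surj_on[OF bij] by (metis imageE)

lemma complement_iso: "generation_iso X Y (\<lambda>A. Y - \<phi> A)"
proof
  have "bij_betw (\<lambda>B. Y - B) (nontrivial_subsets Y) (nontrivial_subsets Y)"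
    by (rule bij_betw_byWitness[where f' = "\<lambda>B. Y - B"])
      (auto simp: nontrivial_subsets_def)
  from bij_betw_trans[OF bij this]
  show "bij_betw (\<lambda>A. Y - \<phi> A) (nontrivial_subsets X) (nontrivial_subsets Y)"
    by (simp add: comp_def)
next
  fix A B assume AB: "A \<in> nontrivial_subsets X" "B \<in> nontrivial_subsets X"
  then have "\<phi> A \<subseteq> Y" "\<phi> B \<subseteq> Y"
    using nontrivial unfolding nontrivial_subsets_def by auto
  then show "(\<lambda>A. Y - \<phi> A) ` generated_pair X A B = generated_pair Y (Y - \<phi> A) (Y - \<phi> B)"
    by (simp add: generated_pair_complement image_image flip: image_generated_pair[OF AB])
qed

lemma extremal_iff:
  assumes A: "A \<in> nontrivial_subsets X"
  shows "\<phi> A \<in> extremal_subsets Y \<longleftrightarrow> A \<in> extremal_subsets X"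
proof -
  have card: "card (generated_pair Y (\<phi> A) (\<phi> B)) = card (generated_pair X A B)"
    if "B \<in> nontrivial_subsets X" for B
    using bij generated_pair_subset[OF A that] image_generated_pair[OF A that]
    by (metis bij_betw_imp_inj_on card_image inj_on_subset)
  have "(\<forall>B\<in>nontrivial_subsets Y. card (generated_pair Y (\<phi> A) B) \<le> 3) \<longleftrightarrow>
      (\<forall>B\<in>nontrivial_subsets X. card (generated_pair Y (\<phi> A) (\<phi> B)) \<le> 3)"
    by (simp flip: bij_betw_imp_surj_on[OF bij])
  then show ?thesis
    using card by (simp add: extremal_subsets_iff A nontrivial)
qed

lemma comparable_or_complementary_iff:
  assumes "A \<in> nontrivial_subsets X" "B \<in> nontrivial_subsets X"
  shows "\<phi> A \<subseteq> \<phi> B \<or> \<phi> B \<subseteq> \<phi> A \<or> \<phi> B = Y - \<phi> A \<longleftrightarrow> A \<subseteq> B \<or> B \<subseteq> A \<or> B = X - A"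
proof -
  have "\<phi> ` generated_pair X A B \<subseteq> \<phi> ` {A, B} \<longleftrightarrow> generated_pair X A B \<subseteq> {A, B}"
    using assms generated_pair_subset[OF assms] by (auto simp: eq_iff subset_iff image_iff)
  then show ?thesis
    using assms by (simp add: image_generated_pair nontrivial flip: generated_pair_subset_pair_iff)
qed

text \<open>
  A singleton and the complement of a singleton are always comparable or complementary, while two
  distinct singletons are neither as soon as there is a third point.  Hence images of both kinds
  cannot occur together.
\<close>

lemma singletons_or_cosingletons:
  assumes "a \<in> X" "b \<in> X" "c \<in> X" "a \<noteq> b" "b \<noteq> c" "a \<noteq> c"
  shows "(\<forall>x\<in>X. \<exists>y\<in>Y. \<phi> {x} = {y}) \<or> (\<forall>x\<in>X. \<exists>y\<in>Y. \<phi> {x} = Y - {y})"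
proof -
  have nt: "{x} \<in> nontrivial_subsets X" if "x \<in> X" for x
    using assms that unfolding nontrivial_subsets_def by auto
  have ext: "\<exists>y\<in>Y. \<phi> {x} = {y} \<or> \<phi> {x} = Y - {y}" if x: "x \<in> X" for x
  proof -
    have "{x} \<in> extremal_subsets X"
      using nt[OF x] x unfolding extremal_subsets_def by auto
    then have "\<phi> {x} \<in> extremal_subsets Y"
      using extremal_iff nt[OF x] by blast
    then show ?thesis
      unfolding extremal_subsets_def by blast
  qed
  have unrelated: "\<not> (\<phi> {x} \<subseteq> \<phi> {x'} \<or> \<phi> {x'} \<subseteq> \<phi> {x} \<or> \<phi> {x'} = Y - \<phi> {x})"
    if x: "x \<in> X" "x' \<in> X" "x \<noteq> x'" for x x'
  proof -
    have "\<exists>z\<in>X. z \<noteq> x \<and> z \<noteq> x'"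
      using assms by metis
    then have "{x'} \<noteq> X - {x}" by blast
    then show ?thesis
      using comparable_or_complementary_iff[OF nt[OF x(1)] nt[OF x(2)]] x by auto
  qed
  have same: "\<not> (\<phi> {x} = {y} \<and> \<phi> {x'} = Y - {y'})" if "x \<in> X" "x' \<in> X" "y \<in> Y" "y' \<in> Y" for x x' y y'
  proof (cases "x = x'")
    case True
    \<comment> \<open>Here \<open>Y\<close> would consist of the two points \<open>y\<close> and \<open>y'\<close>, leaving no room for \<open>\<phi> {z}\<close>.\<close>
    show ?thesis
    proof
      assume y: "\<phi> {x} = {y} \<and> \<phi> {x'} = Y - {y'}"
      obtain z where z: "z \<in> X" "z \<noteq> x"
        using assms by metis
      obtain w where w: "w \<in> Y" "\<phi> {z} = {w} \<or> \<phi> {z} = Y - {w}"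
        using ext[OF z(1)] by blast
      have co: "Y - (Y - {y'}) = {y'}"
        using that(4) by blast
      have "w = y \<or> w = y'"
        using w(1) y True by (metis DiffI singletonD)
      then have "\<phi> {z} = \<phi> {x} \<or> \<phi> {z} = Y - \<phi> {x}"
        using w y co True by metis
      then show False
        using unrelated[OF that(1) z(1)] z(2) by auto
    qed
  next
    case False
    show ?thesis
    proof
      assume y: "\<phi> {x} = {y} \<and> \<phi> {x'} = Y - {y'}"
      have "\<phi> {x'} = Y - \<phi> {x} \<or> \<phi> {x} \<subseteq> \<phi> {x'}"
        using y that(3) by (cases "y = y'") simp_all
      then show False
        using unrelated[OF that(1,2) False] by blast
    qed
  qed
  show ?thesis
    using ext same assms(1) by metis
qed

text \<open>
  For a set \<open>A\<close> that is not extremal, \<open>x \<in> A\<close> holds exactly when \<open>{x}\<close> and \<open>A\<close> are comparable,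
  so \<open>\<phi> A\<close> is known from the images of the singletons.  The relation preserved by \<open>\<phi>\<close> does not
  tell comparable sets from complementary ones, so this says nothing about \<open>x\<close> if \<open>A = X - {x}\<close>.
  Such an \<open>A\<close> is recovered as the only set that \<open>{z}\<close> and \<open>A - {z}\<close>, for a point \<open>z\<close> of \<open>A\<close>,
  generate in addition to themselves.
\<close>

lemma point_map:
  assumes "a \<in> X" "b \<in> X" "c \<in> X" "a \<noteq> b" "b \<noteq> c" "a \<noteq> c"
    and sing: "\<forall>x\<in>X. \<exists>y\<in>Y. \<phi> {x} = {y}"
  obtains \<theta> where "bij_betw \<theta> X Y" "\<And>A. A \<in> nontrivial_subsets X \<Longrightarrow> \<phi> A = \<theta> ` A"
proof -
  obtain \<theta> where \<theta>: "\<And>x. x \<in> X \<Longrightarrow> \<theta> x \<in> Y" "\<And>x. x \<in> X \<Longrightarrow> \<phi> {x} = {\<theta> x}"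
    using sing by metis
  have nt: "{x} \<in> nontrivial_subsets X" if "x \<in> X" for x
    using assms that unfolding nontrivial_subsets_def by auto
  have inj: "inj_on \<theta> X"
    by (rule inj_onI) (metis \<theta>(2) eq_iff nt singleton_inject)
  \<comment> \<open>The set sent to a missed \<open>{y}\<close> would have to be some \<open>X - {x}\<close>.  It is then comparable or
    complementary to \<open>{a}\<close>, whereas \<open>y\<close>, \<open>\<theta> a\<close> and \<open>\<theta> b\<close> are three different points.\<close>
  have surj': "y \<in> \<theta> ` X" if y: "y \<in> Y" for y
  proof (rule ccontr)
    assume out: "y \<notin> \<theta> ` X"
    have ab: "\<theta> a \<in> Y" "\<theta> b \<in> Y" "\<theta> a \<noteq> \<theta> b" "y \<noteq> \<theta> a" "y \<noteq> \<theta> b"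
      using \<theta>(1) assms inj_on_eq_iff[OF inj] out by auto
    then have "{y} \<in> nontrivial_subsets Y"
      using y unfolding nontrivial_subsets_def by auto
    then obtain A where A: "A \<in> nontrivial_subsets X" "\<phi> A = {y}"
      by (rule surj)
    have "A \<in> extremal_subsets X"
      using A y by (subst extremal_iff[symmetric]) (auto simp: extremal_subsets_def dest: nontrivial)
    then obtain x where x: "x \<in> X" "A = {x} \<or> A = X - {x}"
      unfolding extremal_subsets_def by blast
    have "A \<noteq> {x}"
      using A(2) \<theta>(2)[OF x(1)] out x(1) by auto
    with x have AX: "A = X - {x}" by blast
    have "\<theta> b \<in> Y - {\<theta> a}"
      using ab by simp
    then have "{y} \<noteq> Y - {\<theta> a}"
      using ab(5) by (metis singletonD)
    moreover have "{a} \<subseteq> A \<or> A = X - {a}"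
      using AX assms by auto
    ultimately show False
      using comparable_or_complementary_iff[OF nt[OF assms(1)] A(1)] \<theta>(2)[OF assms(1)] A(2) ab
      by auto
  qed
  have bij\<theta>: "bij_betw \<theta> X Y"
    using inj surj' \<theta>(1) unfolding bij_betw_def by blast
  then have img: "\<theta> ` X = Y" by (simp add: bij_betw_def)
  have general: "\<phi> A = \<theta> ` A" if A: "A \<in> nontrivial_subsets X" "\<And>x. x \<in> X \<Longrightarrow> A \<noteq> X - {x}" for A
  proof (cases "\<exists>x. A = {x}")
    case True
    then show ?thesis
      using \<theta>(2) A(1) unfolding nontrivial_subsets_def by auto
  next
    case False
    then have "A \<notin> extremal_subsets X"
      using A unfolding extremal_subsets_def by auto
    then have ext: "\<phi> A \<notin> extremal_subsets Y"
      using extremal_iff A by blast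
    have "\<theta> x \<in> \<phi> A \<longleftrightarrow> x \<in> A" if x: "x \<in> X" for x
    proof -
      have "\<phi> A \<noteq> {\<theta> x}" "\<phi> A \<noteq> Y - {\<theta> x}"
        using ext nontrivial[OF A(1)] \<theta>(1)[OF x] unfolding extremal_subsets_def by auto
      moreover have "\<phi> A \<noteq> {}" "A \<noteq> {}"
        using A(1) nontrivial[OF A(1)] unfolding nontrivial_subsets_def by auto
      moreover have "A \<noteq> {x}" using False by blast
      ultimately show ?thesis
        using comparable_or_complementary_iff[OF nt[OF x] A(1)] \<theta>(2)[OF x] A(2)[OF x]
        by auto
    qed
    then show ?thesis
      using img A(1) nontrivial[OF A(1)] unfolding nontrivial_subsets_def by blast
  qed
  have "\<phi> A = \<theta> ` A" if A: "A \<in> nontrivial_subsets X" for A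
  proof (cases "\<exists>x\<in>X. A = X - {x}")
    case False
    then show ?thesis using general A by blast
  next
    case True
    then obtain x where x: "x \<in> X" "A = X - {x}" by blast
    obtain z z' where z: "z \<in> X" "z' \<in> X" "z \<noteq> x" "z' \<noteq> x" "z \<noteq> z'"
      using assms by metis
    define B where "B = A - {z}"
    have B: "B \<in> nontrivial_subsets X" "\<And>x. x \<in> X \<Longrightarrow> B \<noteq> X - {x}"
      using x z unfolding B_def nontrivial_subsets_def by auto
    have "insert z B = A" "A \<noteq> {}" "A \<noteq> X" "z \<in> A"
      using x z unfolding B_def by auto
    then have "A \<in> generated_pair X {z} B"
      unfolding generated_pair_def by auto
    then have "\<phi> A \<in> \<phi> ` generated_pair X {z} B" by (rule imageI)
    then have "\<phi> A \<in> generated_pair Y {\<theta> z} (\<theta> ` B)"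
      using image_generated_pair[OF nt[OF z(1)] B(1)] \<theta>(2)[OF z(1)] general[OF B] by simp
    moreover have "\<theta> z \<notin> \<theta> ` B"
    proof -
      have "z \<notin> B" "B \<subseteq> X"
        using x unfolding B_def by auto
      then show ?thesis
        by (simp add: inj_on_image_mem_iff[OF inj z(1)])
    qed
    moreover have "z' \<in> A" "z \<notin> B"
      using x z unfolding B_def by simp_all
    then have "A \<noteq> {z}" "A \<noteq> B"
      using z(5) \<open>z \<in> A\<close> by (metis singletonD, metis)
    then have "\<phi> A \<noteq> {\<theta> z}" "\<phi> A \<noteq> \<theta> ` B"
      using eq_iff A nt[OF z(1)] B(1) \<theta>(2)[OF z(1)] general[OF B] by metis+
    ultimately have "\<phi> A = {\<theta> z} \<union> \<theta> ` B"
      unfolding generated_pair_def by auto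
    then show ?thesis
      using \<open>insert z B = A\<close> by auto
  qed
  with bij\<theta> show ?thesis by (rule that)
qed

end

section \<open>From lattice isomorphisms to bijections of sets\<close>

text \<open>
  Only the order matters from here on; \<open>S \<subseteq> T\<close> is the equation \<open>S \<squnion> T = T\<close>.
\<close>

lemma lattice_iso_topology_iff:
  assumes f: "lattice_iso (topology_lattice X) (topology_lattice Y) f"
  shows "bij_betw f (topologies_on X) (topologies_on Y)"
    and "\<And>S T. S \<in> topologies_on X \<Longrightarrow> T \<in> topologies_on X \<Longrightarrow> f S \<subseteq> f T \<longleftrightarrow> S \<subseteq> T"
proof -
  let ?L = "topology_lattice X" and ?M = "topology_lattice Y"
  have simps: "carrier ?L = topologies_on X" "carrier ?M = topologies_on Y"
    "le ?L = (\<subseteq>)" "le ?M = (\<subseteq>)"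
    by (simp_all add: topology_lattice_def)
  show bij: "bij_betw f (topologies_on X) (topologies_on Y)"
    using f by (simp add: lattice_iso_def simps)
  interpret L: lattice ?L
    using f by (simp add: lattice_iso_def join_pres_def)
  interpret M: lattice ?M
    using f by (simp add: lattice_iso_def join_pres_def)
  have join: "\<And>S T. S \<in> topologies_on X \<Longrightarrow> T \<in> topologies_on X \<Longrightarrow>
      f (S \<squnion>\<^bsub>?L\<^esub> T) = f S \<squnion>\<^bsub>?M\<^esub> f T"
    using f by (auto simp: lattice_iso_def join_pres_def simps)
  fix S T assume ST: "S \<in> topologies_on X" "T \<in> topologies_on X"
  have fST: "f S \<in> topologies_on Y" "f T \<in> topologies_on Y"
    using bij ST by (auto dest: bij_betwE)
  have "S \<squnion>\<^bsub>?L\<^esub> T \<in> topologies_on X"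
    using L.join_closed ST by (simp add: simps)
  then have "f (S \<squnion>\<^bsub>?L\<^esub> T) = f T \<longleftrightarrow> S \<squnion>\<^bsub>?L\<^esub> T = T"
    using inj_on_eq_iff[OF bij_betw_imp_inj_on[OF bij]] ST by blast
  then show "f S \<subseteq> f T \<longleftrightarrow> S \<subseteq> T"
    using L.le_iff_meet[of S T] M.le_iff_meet[of "f S" "f T"] ST fST
    by (simp add: simps join)
qed

lemma atom_iff:
  assumes T: "T \<in> topologies_on X"
  shows "(\<exists>A\<in>nontrivial_subsets X. T = {{}, A, X}) \<longleftrightarrow>
    T \<noteq> {{}, X} \<and> (\<forall>S\<in>topologies_on X. S \<subseteq> T \<longrightarrow> S = T \<or> S = {{}, X})"
    (is "?l \<longleftrightarrow> ?r")
proof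
  assume ?l
  then obtain A where A: "A \<in> nontrivial_subsets X" "T = {{}, A, X}" ..
  then have "T \<noteq> {{}, X}"
    unfolding nontrivial_subsets_def by auto
  moreover have "S = T \<or> S = {{}, X}" if "S \<in> topologies_on X" "S \<subseteq> T" for S
    using topologies_onD(2,3)[OF that(1)] that(2) A(2) by auto
  ultimately show ?r by blast
next
  assume r: ?r
  have bot: "{} \<in> T" "X \<in> T"
    using topologies_onD(2,3)[OF T] by auto
  then obtain A where A: "A \<in> T" "A \<noteq> {}" "A \<noteq> X"
    using r by blast
  then have nt: "A \<in> nontrivial_subsets X"
    using topologies_onD(1)[OF T] unfolding nontrivial_subsets_def by auto
  then have "{{}, A, X} \<in> topologies_on X"
    using single_topology unfolding nontrivial_subsets_def by blast
  moreover have "{{}, A, X} \<subseteq> T" "{{}, A, X} \<noteq> {{}, X}"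
    using A bot by auto
  ultimately have "T = {{}, A, X}"
    using r by blast
  with nt show ?l by blast
qed

lemma bottom_iff:
  assumes "T \<in> topologies_on X"
  shows "T = {{}, X} \<longleftrightarrow> (\<forall>S\<in>topologies_on X. T \<subseteq> S)"
proof
  assume "T = {{}, X}"
  then show "\<forall>S\<in>topologies_on X. T \<subseteq> S"
    using topologies_onD(2,3) by blast
next
  assume T: "\<forall>S\<in>topologies_on X. T \<subseteq> S"
  have "{{}, X} \<in> topologies_on X"
    using single_topology[of "{}" X] by simp
  then show "T = {{}, X}"
    using T[rule_format] topologies_onD(2,3)[OF assms] by (intro equalityI) auto
qed

text \<open>
  Atoms are defined by the order, so the isomorphism permits \<open>\<phi> A\<close> to be defined by
  \<open>f {\<emptyset>, A, X} = {\<emptyset>, \<phi> A, Y}\<close>; applying \<open>f\<close> to \<open>{\<emptyset>, A, X} \<subseteq> T\<close> gives the rule for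
  membership, and this transports \<open>generated_pair_iff\<close>.
\<close>

lemma order_iso_generation_iso:
  assumes bij: "bij_betw f (topologies_on X) (topologies_on Y)"
    and mono: "\<And>S T. S \<in> topologies_on X \<Longrightarrow> T \<in> topologies_on X \<Longrightarrow> f S \<subseteq> f T \<longleftrightarrow> S \<subseteq> T"
  obtains \<phi> where "generation_iso X Y \<phi>"
    "\<And>A T. A \<in> nontrivial_subsets X \<Longrightarrow> T \<in> topologies_on X \<Longrightarrow> \<phi> A \<in> f T \<longleftrightarrow> A \<in> T"
proof -
  have ran: "f ` topologies_on X = topologies_on Y"
    using bij by (simp add: bij_betw_def)
  have inj: "f S = f T \<longleftrightarrow> S = T" if "S \<in> topologies_on X" "T \<in> topologies_on X" for S T
    using bij that by (meson bij_betw_imp_inj_on inj_on_eq_iff)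
  have all: "(\<forall>S\<in>topologies_on Y. P S) \<longleftrightarrow> (\<forall>S\<in>topologies_on X. P (f S))" for P
    by (simp flip: ran)
  have top: "f T \<in> topologies_on Y" if "T \<in> topologies_on X" for T
    using ran that by blast
  have bot: "f T = {{}, Y} \<longleftrightarrow> T = {{}, X}" if T: "T \<in> topologies_on X" for T
    using T by (simp add: bottom_iff top all mono)
  have atom: "(\<exists>B\<in>nontrivial_subsets Y. f T = {{}, B, Y}) \<longleftrightarrow>
      (\<exists>A\<in>nontrivial_subsets X. T = {{}, A, X})" if T: "T \<in> topologies_on X" for T
    using T by (simp add: atom_iff top all mono bot inj)
  have single: "{{}, A, X} \<in> topologies_on X" if "A \<in> nontrivial_subsets X" for A
    using that single_topology unfolding nontrivial_subsets_def by blast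
  have "\<exists>B\<in>nontrivial_subsets Y. f {{}, A, X} = {{}, B, Y}" if "A \<in> nontrivial_subsets X" for A
    using atom[OF single[OF that]] that by blast
  then obtain \<phi> where \<phi>: "\<And>A. A \<in> nontrivial_subsets X \<Longrightarrow> \<phi> A \<in> nontrivial_subsets Y"
    "\<And>A. A \<in> nontrivial_subsets X \<Longrightarrow> f {{}, A, X} = {{}, \<phi> A, Y}"
    by metis
  have mem: "\<phi> A \<in> f T \<longleftrightarrow> A \<in> T" if A: "A \<in> nontrivial_subsets X" and T: "T \<in> topologies_on X" for A T
  proof -
    have "\<phi> A \<in> f T \<longleftrightarrow> f {{}, A, X} \<subseteq> f T"
      using \<phi>(2)[OF A] topologies_onD(2,3)[OF top[OF T]] by simp
    also have "\<dots> \<longleftrightarrow> A \<in> T"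
      using mono[OF single[OF A] T] topologies_onD(2,3)[OF T] by simp
    finally show ?thesis .
  qed
  have "A = B" if AB: "A \<in> nontrivial_subsets X" "B \<in> nontrivial_subsets X" "\<phi> A = \<phi> B" for A B
    using mem[OF AB(1) single[OF AB(2)]] mem[OF AB(2) single[OF AB(2)]] AB
    unfolding nontrivial_subsets_def by auto
  then have inj\<phi>: "inj_on \<phi> (nontrivial_subsets X)"
    by (rule inj_onI)
  have surj\<phi>: "B \<in> \<phi> ` nontrivial_subsets X" if B: "B \<in> nontrivial_subsets Y" for B
  proof -
    have "{{}, B, Y} \<in> topologies_on Y"
      using B single_topology unfolding nontrivial_subsets_def by blast
    then obtain T where T: "T \<in> topologies_on X" "f T = {{}, B, Y}"
      using ran by (metis imageE)
    then obtain A where A: "A \<in> nontrivial_subsets X" "T = {{}, A, X}"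
      using atom[OF T(1)] B by blast
    then have "B = \<phi> A"
      using \<phi>(2)[OF A(1)] T(2) by (intro single_topology_inject[OF B]) simp
    with A(1) show ?thesis by blast
  qed
  have bij\<phi>: "bij_betw \<phi> (nontrivial_subsets X) (nontrivial_subsets Y)"
    using inj\<phi> surj\<phi> \<phi>(1) unfolding bij_betw_def by blast
  have iso: "generation_iso X Y \<phi>"
  proof
    fix A B assume AB: "A \<in> nontrivial_subsets X" "B \<in> nontrivial_subsets X"
    have "\<phi> C \<in> generated_pair Y (\<phi> A) (\<phi> B) \<longleftrightarrow> C \<in> generated_pair X A B"
      if "C \<in> nontrivial_subsets X" for C
      using AB that by (simp add: generated_pair_iff \<phi>(1) all mem)
    then show "\<phi> ` generated_pair X A B = generated_pair Y (\<phi> A) (\<phi> B)"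
      using generated_pair_subset[OF AB] generated_pair_subset[OF AB[THEN \<phi>(1)]] surj\<phi> by blast
  qed (rule bij\<phi>)
  show ?thesis
    by (rule that[OF iso mem])
qed

section \<open>Reading off the isomorphism\<close>

lemma preimage_nontrivial:
  assumes "bij_betw \<theta> X Y" "V \<in> nontrivial_subsets Y"
  shows "\<theta> -` V \<inter> X \<in> nontrivial_subsets X" "\<theta> ` (\<theta> -` V \<inter> X) = V"
  using assms unfolding bij_betw_def nontrivial_subsets_def by auto

lemma eq_induced_map:
  assumes \<theta>: "bij_betw \<theta> X Y"
    and T: "T \<in> topologies_on X" and S: "S \<in> topologies_on Y"
    and mem: "\<And>A. A \<in> nontrivial_subsets X \<Longrightarrow> \<theta> ` A \<in> S \<longleftrightarrow> A \<in> T"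
  shows "S = induced_map X Y \<theta> T"
proof -
  have "V \<in> S \<longleftrightarrow> \<theta> -` V \<inter> X \<in> T" if V: "V \<subseteq> Y" for V
  proof (cases "V \<in> nontrivial_subsets Y")
    case True
    then show ?thesis
      using preimage_nontrivial[OF \<theta> True] mem by metis
  next
    case False
    moreover have "\<theta> -` Y \<inter> X = X"
      using \<theta> unfolding bij_betw_def by auto
    ultimately show ?thesis
      using V topologies_onD(2,3)[OF T] topologies_onD(2,3)[OF S]
      unfolding nontrivial_subsets_def by auto
  qed
  then show ?thesis
    using topologies_onD(1)[OF S] unfolding induced_map_def by auto
qed

lemma complement_map_complement_map:
  "T \<subseteq> Pow Y \<Longrightarrow> complement_map Y (complement_map Y T) = T"
  unfolding complement_map_def by (auto simp: double_diff)

lemma complement_map_mem_iff: "T \<subseteq> Pow Y \<Longrightarrow> V \<subseteq> Y \<Longrightarrow> V \<in> complement_map Y T \<longleftrightarrow> Y - V \<in> T"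
  unfolding complement_map_def by (auto simp: double_diff)

lemma complement_map_topology:
  assumes "finite Y" "T \<in> topologies_on Y"
  shows "complement_map Y T \<in> topologies_on Y"
proof (rule finite_topologyI)
  note T = topologies_onD[OF assms(2)]
  show sub: "complement_map Y T \<subseteq> Pow Y"
    unfolding complement_map_def by auto
  then show "finite (complement_map Y T)"
    using assms(1) finite_subset by blast
  show "{} \<in> complement_map Y T" "Y \<in> complement_map Y T"
    using T(1-3) by (simp_all add: complement_map_mem_iff)
  fix A B assume AB: "A \<in> complement_map Y T" "B \<in> complement_map Y T"
  then have "A \<subseteq> Y" "B \<subseteq> Y" using sub by auto
  then show "A \<inter> B \<in> complement_map Y T" "A \<union> B \<in> complement_map Y T"
    using AB T(1,4,5) by (simp_all add: complement_map_mem_iff Diff_Int Diff_Un le_infI1)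
qed

lemma cofinite_topology: "{U. U \<subseteq> X \<and> (U = {} \<or> finite (X - U))} \<in> topologies_on X"
proof -
  have "finite (X - \<Union>K)" if K: "K \<subseteq> {U. U \<subseteq> X \<and> (U = {} \<or> finite (X - U))}" "\<Union>K \<noteq> {}" for K
  proof -
    obtain U where U: "U \<in> K" "U \<noteq> {}" using K(2) by blast
    then have "finite (X - U)" using K(1) by blast
    then show ?thesis
      by (rule rev_finite_subset) (use U in blast)
  qed
  then show ?thesis
    unfolding topologies_on_iff by (auto simp: Diff_Int)
qed

lemma induced_map_single:
  assumes "bij_betw \<theta> X Y" "A \<subseteq> X"
  shows "induced_map X Y \<theta> {{}, A, X} = {{}, \<theta> ` A, Y}"
proof -
  have inj: "inj_on \<theta> X" and img: "\<theta> ` X = Y"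
    using assms(1) by (simp_all add: bij_betw_def)
  have "\<theta> -` V \<inter> X = B \<longleftrightarrow> V = \<theta> ` B" if "V \<subseteq> Y" "B \<subseteq> X" for V B
  proof
    show "V = \<theta> ` B" if "\<theta> -` V \<inter> X = B"
      using that \<open>V \<subseteq> Y\<close> img by blast
    show "\<theta> -` V \<inter> X = B" if "V = \<theta> ` B"
      unfolding that using \<open>B \<subseteq> X\<close> inj unfolding inj_on_def by blast
  qed
  note eq = this
  have "V \<in> induced_map X Y \<theta> {{}, A, X} \<longleftrightarrow> V \<in> {{}, \<theta> ` A, Y}" for V
  proof (cases "V \<subseteq> Y")
    case True
    then show ?thesis
      by (simp add: induced_map_def eq assms(2) img)
  next
    case False
    moreover have "\<theta> ` A \<subseteq> Y"
      using img assms(2) by blast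
    ultimately show ?thesis
      by (auto simp: induced_map_def)
  qed
  then show ?thesis by blast
qed

text \<open>
  With at most two points there are no pairs to compare, but then the nonempty proper subsets are
  singletons and \<open>\<phi>\<close>, being a bijection between them, comes from a bijection of points; complements
  bring nothing new, which is why that alternative can be restricted to larger sets.
\<close>

lemma (in generation_iso) image_or_complement:
  assumes "X \<noteq> {}" "Y \<noteq> {}"
  obtains (image) \<theta> where "bij_betw \<theta> X Y" "\<And>A. A \<in> nontrivial_subsets X \<Longrightarrow> \<phi> A = \<theta> ` A"
  | (complement) \<theta> where "bij_betw \<theta> X Y" "\<And>A. A \<in> nontrivial_subsets X \<Longrightarrow> \<phi> A = Y - \<theta> ` A"
      "finite X \<Longrightarrow> card X > 2"
proof (cases "\<exists>a\<in>X. \<exists>b\<in>X. \<exists>c\<in>X. a \<noteq> b \<and> b \<noteq> c \<and> a \<noteq> c")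
  case True
  then obtain a b c where abc: "a \<in> X" "b \<in> X" "c \<in> X" "a \<noteq> b" "b \<noteq> c" "a \<noteq> c"
    by blast
  from singletons_or_cosingletons[OF abc] show ?thesis
  proof
    assume "\<forall>x\<in>X. \<exists>y\<in>Y. \<phi> {x} = {y}"
    from point_map[OF abc this] obtain \<theta> where
      "bij_betw \<theta> X Y" "\<And>A. A \<in> nontrivial_subsets X \<Longrightarrow> \<phi> A = \<theta> ` A"
      by blast
    then show ?thesis by (rule image)
  next
    assume co: "\<forall>x\<in>X. \<exists>y\<in>Y. \<phi> {x} = Y - {y}"
    interpret C: generation_iso X Y "\<lambda>A. Y - \<phi> A"
      by (rule complement_iso)
    have "\<forall>x\<in>X. \<exists>y\<in>Y. Y - \<phi> {x} = {y}"
    proof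
      fix x assume "x \<in> X"
      then obtain y where "y \<in> Y" "\<phi> {x} = Y - {y}"
        using co by blast
      then show "\<exists>y\<in>Y. Y - \<phi> {x} = {y}"
        by (intro bexI[of _ y]) auto
    qed
    from C.point_map[OF abc this] obtain \<theta> where
      \<theta>: "bij_betw \<theta> X Y" "\<And>A. A \<in> nontrivial_subsets X \<Longrightarrow> Y - \<phi> A = \<theta> ` A"
      by blast
    have "\<phi> A = Y - \<theta> ` A" if A: "A \<in> nontrivial_subsets X" for A
      using \<theta>(2)[OF A] nontrivial[OF A] unfolding nontrivial_subsets_def by auto
    moreover have "card X > 2" if "finite X"
    proof -
      have "card {a, b, c} \<le> card X"
        using abc that by (intro card_mono) auto
      then show ?thesis using abc by simp
    qed
    ultimately show ?thesis
      using \<theta>(1) by (rule complement[rotated])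
  qed
next
  case False
  obtain x where x: "x \<in> X" using assms by blast
  show ?thesis
  proof (cases "X = {x}")
    case True
    then have "nontrivial_subsets X = {}"
      unfolding nontrivial_subsets_def by auto
    then have none: "nontrivial_subsets Y = {}"
      using bij by (simp add: bij_betw_def)
    obtain y where "y \<in> Y" using assms by blast
    moreover have "{y} \<notin> nontrivial_subsets Y"
      using none by simp
    ultimately have "Y = {y}"
      by (simp add: nontrivial_subsets_def)
    then have "bij_betw (\<lambda>_. y) X Y"
      using True by (simp add: bij_betw_def)
    then show ?thesis
      using image \<open>nontrivial_subsets X = {}\<close> by blast
  next
    case nsing: False
    then obtain x' where x': "x' \<in> X" "x' \<noteq> x"
      using x by blast
    have X: "X = {x, x'}"
      using False x x' by blast
    have ntX: "nontrivial_subsets X = {{x}, {x'}}"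
      using x'(2) unfolding X nontrivial_subsets_def by auto
    then have ntY: "nontrivial_subsets Y = {\<phi> {x}, \<phi> {x'}}"
      using bij by (simp add: bij_betw_def)
    have "\<phi> {x} \<in> nontrivial_subsets Y"
      unfolding ntY by simp
    then have B: "\<phi> {x} \<subseteq> Y" "\<phi> {x} \<noteq> {}" "\<phi> {x} \<noteq> Y"
      unfolding nontrivial_subsets_def by simp_all
    then have "Y - \<phi> {x} \<in> nontrivial_subsets Y" "Y - \<phi> {x} \<noteq> \<phi> {x}"
      unfolding nontrivial_subsets_def by auto
    then have co: "\<phi> {x'} = Y - \<phi> {x}"
      using ntY by auto
    have sing: "{y} = \<phi> {x} \<or> {y} = Y - \<phi> {x}" if "y \<in> Y" for y
    proof -
      have "{y} \<in> nontrivial_subsets Y"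
        using that B unfolding nontrivial_subsets_def by auto
      then show ?thesis using ntY co by auto
    qed
    obtain y y' where y: "y \<in> \<phi> {x}" "y' \<in> Y" "y' \<notin> \<phi> {x}"
      using B by blast
    then have img: "\<phi> {x} = {y}" "\<phi> {x'} = {y'}" "Y = {y, y'}"
      using sing[of y] sing[of y'] B co by auto
    define \<theta> where "\<theta> = (\<lambda>z. if z = x then y else y')"
    have "bij_betw \<theta> X Y"
      using x' y img(1) unfolding X img(3) \<theta>_def bij_betw_def by auto
    moreover have "\<phi> A = \<theta> ` A" if "A \<in> nontrivial_subsets X" for A
      using that x'(2) img(1,2) unfolding ntX \<theta>_def by auto
    ultimately show ?thesis
      by (rule image)
  qed
qed

text \<open>
  If \<open>S\<close> corresponds to the cofinite topology under \<open>A \<mapsto> Y - \<theta> ` A\<close>, all singletons of \<open>Y\<close> are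
  open in \<open>S\<close>, hence so is the complement of a point \<open>\<theta> x\<^sub>0\<close>; but this forces \<open>{x\<^sub>0}\<close> to be cofinite.
\<close>

lemma complement_infinite_False:
  assumes \<theta>: "bij_betw \<theta> X Y" and inf: "infinite X"
    and S: "S \<in> topologies_on Y"
    and mem: "\<And>A. A \<in> nontrivial_subsets X \<Longrightarrow>
      Y - \<theta> ` A \<in> S \<longleftrightarrow> A \<in> {U. U \<subseteq> X \<and> (U = {} \<or> finite (X - U))}"
  shows False
proof -
  have inj: "inj_on \<theta> X" and img: "\<theta> ` X = Y"
    using \<theta> by (simp_all add: bij_betw_def)
  have co: "Y - \<theta> ` A = \<theta> ` (X - A)" if "A \<subseteq> X" for A
    using that img inj_on_image_set_diff[OF inj, of X A] by auto
  obtain x0 where x0: "x0 \<in> X"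
    using inf by (metis finite.emptyI ex_in_conv)
  have sing: "{\<theta> x} \<in> S" if x: "x \<in> X" for x
  proof -
    have "X - {x} \<noteq> {}"
      using inf by (metis finite.emptyI infinite_remove)
    then have "X - {x} \<in> nontrivial_subsets X"
      using x unfolding nontrivial_subsets_def by auto
    moreover have "X - (X - {x}) = {x}" using x by auto
    ultimately show ?thesis
      using mem[of "X - {x}"] co[of "X - {x}"] by auto
  qed
  have "\<Union>((\<lambda>x. {\<theta> x}) ` (X - {x0})) \<in> S"
    using sing by (intro topologies_onD(6)[OF S]) auto
  also have "\<Union>((\<lambda>x. {\<theta> x}) ` (X - {x0})) = Y - \<theta> ` {x0}"
    using x0 by (subst co) auto
  finally have "Y - \<theta> ` {x0} \<in> S" .
  moreover have "{x0} \<in> nontrivial_subsets X"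
    using inf x0 unfolding nontrivial_subsets_def by auto
  ultimately have "finite (X - {x0})"
    using mem[of "{x0}"] by simp
  with inf show False by simp
qed

theorem lemmaA:
  fixes X :: "'a set" and Y :: "'b set" and \<Theta> :: "'a set set \<Rightarrow> 'b set set"
  assumes "X \<noteq> {}" and "Y \<noteq> {}"
    and "lattice_iso (topology_lattice X) (topology_lattice Y) \<Theta>"
  shows "\<exists>!\<theta>. \<theta> \<in> extensional X \<and> bij_betw \<theta> X Y \<and>
    (card X = 1 \<or> card X = 2 \<or> infinite X \<longrightarrow>
       (\<forall>T\<in>topologies_on X. \<Theta> T = induced_map X Y \<theta> T)) \<and>
    (finite X \<and> card X > 2 \<longrightarrow>
       (\<forall>T\<in>topologies_on X. \<Theta> T = induced_map X Y \<theta> T) \<or>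
       (\<forall>T\<in>topologies_on X. \<Theta> T = (complement_map Y \<circ> induced_map X Y \<theta>) T))"
proof -
  note bij\<Theta> = lattice_iso_topology_iff(1)[OF assms(3)]
  have top: "\<Theta> T \<in> topologies_on Y" if "T \<in> topologies_on X" for T
    using bij\<Theta> that by (auto dest: bij_betwE)
  obtain \<phi> where iso: "generation_iso X Y \<phi>"
    and mem: "\<And>A T. A \<in> nontrivial_subsets X \<Longrightarrow> T \<in> topologies_on X \<Longrightarrow> \<phi> A \<in> \<Theta> T \<longleftrightarrow> A \<in> T"
    using order_iso_generation_iso[OF lattice_iso_topology_iff[OF assms(3)]] by blast
  interpret generation_iso X Y \<phi>
    by (rule iso)
  let ?image = "\<lambda>\<theta>. \<forall>T\<in>topologies_on X. \<Theta> T = induced_map X Y \<theta> T"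
  let ?complement = "\<lambda>\<theta>. \<forall>T\<in>topologies_on X. \<Theta> T = (complement_map Y \<circ> induced_map X Y \<theta>) T"
  let ?Q = "\<lambda>\<theta>. \<theta> \<in> extensional X \<and> bij_betw \<theta> X Y \<and>
    (card X = 1 \<or> card X = 2 \<or> infinite X \<longrightarrow> ?image \<theta>) \<and>
    (finite X \<and> card X > 2 \<longrightarrow> ?image \<theta> \<or> ?complement \<theta>)"
  have "\<exists>\<theta>. bij_betw \<theta> X Y \<and> (?image \<theta> \<or> finite X \<and> card X > 2 \<and> ?complement \<theta>)"
  proof -
    consider (image) \<theta> where "bij_betw \<theta> X Y" "\<And>A. A \<in> nontrivial_subsets X \<Longrightarrow> \<phi> A = \<theta> ` A"
      | (complement) \<theta> where "bij_betw \<theta> X Y" "\<And>A. A \<in> nontrivial_subsets X \<Longrightarrow> \<phi> A = Y - \<theta> ` A"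
        "finite X \<Longrightarrow> card X > 2"
      using image_or_complement[OF assms(1,2)] by blast
    then show ?thesis
    proof cases
      case (image \<theta>)
      then have "\<Theta> T = induced_map X Y \<theta> T" if "T \<in> topologies_on X" for T
        using that mem top by (intro eq_induced_map) auto
      with image(1) show ?thesis by blast
    next
      case (complement \<theta>)
      have fin: "finite X"
      proof (rule ccontr)
        assume inf: "infinite X"
        show False
          by (rule complement_infinite_False[OF complement(1) inf top[OF cofinite_topology]])
            (use complement(2) mem[OF _ cofinite_topology] in simp)
      qed
      have "\<Theta> T = complement_map Y (induced_map X Y \<theta> T)" if T: "T \<in> topologies_on X" for T
      proof -
        have "finite Y"
          using fin complement(1) bij_betw_finite by blast
        then have "complement_map Y (\<Theta> T) = induced_map X Y \<theta> T"
        proof (intro eq_induced_map[OF complement(1) T] complement_map_topology top[OF T])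
          fix A assume A: "A \<in> nontrivial_subsets X"
          then have "\<theta> ` A \<subseteq> Y"
            using complement(1) unfolding bij_betw_def nontrivial_subsets_def by auto
          then show "\<theta> ` A \<in> complement_map Y (\<Theta> T) \<longleftrightarrow> A \<in> T"
            using complement(2)[OF A] mem[OF A T] topologies_onD(1)[OF top[OF T]]
            by (simp add: complement_map_mem_iff)
        qed
        then show ?thesis
          using topologies_onD(1)[OF top[OF T]] by (metis complement_map_complement_map)
      qed
      with complement(1,3) fin show ?thesis by auto
    qed
  qed
  then obtain \<theta> where \<theta>: "bij_betw \<theta> X Y" "?image \<theta> \<or> finite X \<and> card X > 2 \<and> ?complement \<theta>"
    by blast
  have "induced_map X Y (restrict \<theta> X) = induced_map X Y \<theta>"
  proof -
    have "restrict \<theta> X -` V \<inter> X = \<theta> -` V \<inter> X" for V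
      by auto
    then show ?thesis
      by (simp add: induced_map_def fun_eq_iff)
  qed
  then have exists: "?Q (restrict \<theta> X)"
    using \<theta> by auto
  have unique: "\<theta>1 = \<theta>2" if Q: "?Q \<theta>1" "?Q \<theta>2" for \<theta>1 \<theta>2
  proof (rule extensionalityI)
    show "\<theta>1 \<in> extensional X" "\<theta>2 \<in> extensional X"
      using Q by blast+
    fix x assume x: "x \<in> X"
    have bij12: "bij_betw \<theta>1 X Y" "bij_betw \<theta>2 X Y"
      using Q by blast+
    have Y: "\<theta>1 x \<in> Y" "\<theta>2 x \<in> Y"
      using bij12[THEN bij_betwE] x by blast+
    show "\<theta>1 x = \<theta>2 x"
    proof (cases "X = {x}")
      case True
      then have "Y = {\<theta>1 x}"
        using bij12(1) by (auto simp: bij_betw_def)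
      with Y show ?thesis by auto
    next
      case False
      have T: "{{}, {x}, X} \<in> topologies_on X"
        using x by (intro single_topology) simp
      have nontriv: "{\<theta> x} \<in> nontrivial_subsets Y" "Y - {\<theta> x} \<in> nontrivial_subsets Y"
        if "bij_betw \<theta> X Y" for \<theta>
      proof -
        obtain z where "z \<in> X" "z \<noteq> x" using False x by blast
        then have "\<theta> z \<in> Y" "\<theta> z \<noteq> \<theta> x" "\<theta> x \<in> Y"
          using that x by (auto simp: bij_betw_def inj_on_eq_iff)
        then show "{\<theta> x} \<in> nontrivial_subsets Y" "Y - {\<theta> x} \<in> nontrivial_subsets Y"
          unfolding nontrivial_subsets_def by auto
      qed
      have val: "\<exists>B\<in>nontrivial_subsets Y. \<Theta> {{}, {x}, X} = {{}, B, Y} \<and>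
          (B = {\<theta> x} \<or> finite X \<and> card X > 2 \<and> B = Y - {\<theta> x})" if Q: "?Q \<theta>" for \<theta>
      proof -
        have bij: "bij_betw \<theta> X Y" using Q by blast
        have "finite X \<Longrightarrow> card X \<noteq> 0" using x by auto
        then have "?image \<theta> \<or> finite X \<and> card X > 2 \<and> ?complement \<theta>"
          using Q by (metis One_nat_def Suc_1 less_one linorder_neqE_nat less_Suc_eq)
        then show ?thesis
        proof
          assume "?image \<theta>"
          then have "\<Theta> {{}, {x}, X} = {{}, {\<theta> x}, Y}"
            using T x induced_map_single[OF bij, of "{x}"] by simp
          then show ?thesis using nontriv(1)[OF bij] by blast
        next
          assume co: "finite X \<and> card X > 2 \<and> ?complement \<theta>"
          then have "\<Theta> {{}, {x}, X} = complement_map Y {{}, {\<theta> x}, Y}"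
            using T x induced_map_single[OF bij, of "{x}"] by simp
          also have "\<dots> = {{}, Y - {\<theta> x}, Y}"
            unfolding complement_map_def by auto
          finally show ?thesis using nontriv(2)[OF bij] co by blast
        qed
      qed
      obtain B where B: "B \<in> nontrivial_subsets Y" "\<Theta> {{}, {x}, X} = {{}, B, Y}"
        "B = {\<theta>1 x} \<or> finite X \<and> card X > 2 \<and> B = Y - {\<theta>1 x}"
        using val[OF Q(1)] by blast
      obtain B' where B': "\<Theta> {{}, {x}, X} = {{}, B', Y}"
        "B' = {\<theta>2 x} \<or> finite X \<and> card X > 2 \<and> B' = Y - {\<theta>2 x}"
        using val[OF Q(2)] by blast
      have "B = B'"
        using single_topology_inject[OF B(1)] B(2) B'(1) by simp
      moreover have mixed: "{y} \<noteq> Y - {y'}" if "finite X" "card X > 2" for y y'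
      proof
        assume "{y} = Y - {y'}"
        then have "Y \<subseteq> {y, y'}" by blast
        then have "card Y \<le> card {y, y'}" by (intro card_mono) auto
        also have "\<dots> \<le> 2" by (simp add: card_insert_if)
        finally show False
          using that(2) bij_betw_same_card[OF bij12(1)] by simp
      qed
      ultimately have "{\<theta>1 x} = {\<theta>2 x} \<or> Y - {\<theta>1 x} = Y - {\<theta>2 x}"
        using B(3) B'(2) by metis
      then show ?thesis using Y by blast
    qed
  qed
  show ?thesis
  proof (rule ex1I[of ?Q "restrict \<theta> X"])
    show "?Q (restrict \<theta> X)"
      by (rule exists)
    show "\<theta>' = restrict \<theta> X" if "?Q \<theta>'" for \<theta>'
      using that exists by (rule unique)
  qed
qed

end
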